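(* Let $\mathcal{P}$ be the set of integer partitions in which $1$ does not appear as a part and in which, for every positive integer $i$, none of the following occurs as a sub-partition: $i+i+i$; $i+i+(i+1)$; $i+(i+1)+(i+2)+(i+2)$; $i+(i+1)+(i+2)+(i+3)$; $i+(i+1)+(i+1)+(i+3)+(i+3)$. Then, as formal power series in $x,q$, writing $M=i+2j+3k+4l$, $$\sum_{\pi\in\mathcal{P}}x^{\ell(\pi)}q^{|\pi|}=\sum_{i,j,k,l\ge 0}(-1)^l\frac{x^{M}q^{\frac{M(M-1)}{2}+2l^2+2i+3j+5k+6l}}{(q;q)_i\,(q^2;q^2)_j\,(q^3;q^3)_k\,(q^4;q^4)_l}.$$
   Context: Partitions are finite weakly increasing sequences of positive integers (the empty partition is included); $\ell(\pi)$ is the number of parts and $|\pi|$ the sum of the parts of $\pi$. A sub-partition of a partition is a contiguous portion of it. For $n\ge 0$, $(a;q)_n=\prod_{0\le t<n}(1-aq^t)$. All identities are identities of formal power series. *)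

theory Defs
  imports
    "HOL-Analysis.Infinite_Sum"
    "HOL-Computational_Algebra.Formal_Power_Series"
    "HOL-Library.Sublist"
begin

definition is_partition :: "nat list \<Rightarrow> bool" where
  "is_partition p \<longleftrightarrow> sorted p \<and> (\<forall>a \<in> set p. a > 0)"

text \<open>
  A sub-partition is a contiguous portion, i.e. the library relation \<open>sublist\<close>
  (contiguous factor of a list), not \<open>subseq\<close>.
\<close>

definition restricted_partitions :: "nat list set" where
  "restricted_partitions =
     {p. is_partition p \<and> 1 \<notin> set p \<and>
         (\<forall>i>0. \<not> sublist [i, i, i] p \<and>
                \<not> sublist [i, i, i + 1] p \<and>
                \<not> sublist [i, i + 1, i + 2, i + 2] p \<and>
                \<not> sublist [i, i + 1, i + 2, i + 3] p \<and>
                \<not> sublist [i, i + 1, i + 1, i + 3, i + 3] p)}"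

text \<open>
  Formal power series in \<open>x\<close>, \<open>q\<close> are power series in \<open>q\<close> whose coefficients are
  power series in \<open>x\<close>. Infinite sums are taken in the library's \<open>q\<close>-adic topology
  on the outer series. The order of the variables matters here: there are infinitely
  many partitions of a given length, but only finitely many of a given size.
  The coefficients are rational only because the library's division of power series
  requires an \<open>inverse\<close> operation on the coefficients; every denominator that is used
  has constant term 1 and hence is a unit.
\<close>

definition qvar :: "rat fps fps" where
  "qvar = fps_X"

definition xvar :: "rat fps fps" where
  "xvar = fps_const fps_X"

definition qpochhammer :: "'a::comm_ring_1 \<Rightarrow> 'a \<Rightarrow> nat \<Rightarrow> 'a" where
  "qpochhammer a q n = (\<Prod>t<n. 1 - a * q ^ t)"

definition multisum_term :: "nat \<Rightarrow> nat \<Rightarrow> nat \<Rightarrow> nat \<Rightarrow> rat fps fps" where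
  "multisum_term i j k l =
     (let M = i + 2 * j + 3 * k + 4 * l in
       (- 1) ^ l * (xvar ^ M * qvar ^ (M * (M - 1) div 2 + 2 * l\<^sup>2 + 2 * i + 3 * j + 5 * k + 6 * l))
         / (qpochhammer qvar qvar i * qpochhammer (qvar ^ 2) (qvar ^ 2) j *
            qpochhammer (qvar ^ 3) (qvar ^ 3) k * qpochhammer (qvar ^ 4) (qvar ^ 4) l))"

end

theory Submission
  imports Defs
begin

text \<open>
  Write both sides as power series \<open>F\<close> in \<open>x\<close> over series in \<open>q\<close>. Splitting off the smallest parts
  of a restricted partition, and using that raising every part by one replaces \<open>x\<close> by \<open>xq\<close>, gives

  \<open>F(x) = F(xq) + (xq^2 + x^2q^4) F(xq^2) + (x^2q^5 + x^3q^8) F(xq^3) + x^3q^9 F(xq^4) - x^5q^18 F(xq^5)\<close>,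

  which together with \<open>F(0) = 1\<close> determines \<open>F\<close>. On the other side, without the factor
  \<open>q^(M(M-1)/2)\<close> the multisum is the product
  \<open>G(z) = (z^4q^8; q^4) / ((zq^2; q) (z^2q^3; q^2) (z^3q^5; q^3))\<close> (all infinite), and
  \<open>1 - z^4q^8 = (1 - zq^2)(1 + zq^2)(1 + z^2q^4)\<close> yields
  \<open>G(zq) (1 + zq^2)(1 + z^2q^4) = G(z) (1 - z^2q^3)(1 - z^3q^5)\<close>. Multiplying the coefficient of
  \<open>z^M\<close> by \<open>q^(M(M-1)/2)\<close> turns this into the same equation for \<open>F\<close>.
\<close>

unbundle fps_syntax

subsection \<open>A q-difference equation\<close>

definition dilate :: "'a::comm_ring_1 \<Rightarrow> 'a fps \<Rightarrow> 'a fps" where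
  "dilate c f = Abs_fps (\<lambda>n. c ^ n * f $ n)"

lemma dilate_nth [simp]: "dilate c f $ n = c ^ n * f $ n"
  by (simp add: dilate_def)

lemma dilate_mult: "dilate c (f * g) = dilate c f * dilate c g"
proof (rule fps_ext)
  fix n
  have "c ^ n = c ^ i * c ^ (n - i)" if "i \<le> n" for i
    using that by (simp flip: power_add)
  then show "dilate c (f * g) $ n = (dilate c f * dilate c g) $ n"
    by (simp add: fps_mult_nth sum_distrib_left mult.assoc mult.left_commute)
qed

lemma dilate_dilate: "dilate c (dilate d f) = dilate (c * d) f"
  by (rule fps_ext) (simp add: power_mult_distrib mult.assoc)

text \<open>Supplies the factor \<open>q^(M(M-1)/2)\<close> of the multisum, as a binomial
  coefficient because \<open>choose_two_add\<close> splits that additively.\<close>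

definition triangular_twist :: "'a::comm_ring_1 \<Rightarrow> 'a fps \<Rightarrow> 'a fps" where
  "triangular_twist q f = Abs_fps (\<lambda>n. q ^ (n choose 2) * f $ n)"

lemma triangular_twist_nth [simp]: "triangular_twist q f $ n = q ^ (n choose 2) * f $ n"
  by (simp add: triangular_twist_def)

lemma triangular_twist_add: "triangular_twist q (f + g) = triangular_twist q f + triangular_twist q g"
  by (rule fps_ext) (simp add: distrib_left)

lemma triangular_twist_diff: "triangular_twist q (f - g) = triangular_twist q f - triangular_twist q g"
  by (rule fps_ext) (simp add: right_diff_distrib)

lemma choose_two_add: "(m + a) choose 2 = (m choose 2) + a * m + (a choose 2)"
  by (induction a) (simp_all add: numeral_2_eq_2)

text \<open>In \<open>choose_two_add\<close> the cross term \<open>a * m\<close> amounts to a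
  further dilation by \<open>q ^ a\<close>, and \<open>a choose 2\<close> goes into the
  coefficient.\<close>

lemma triangular_twist_monom_mult_dilate:
  "triangular_twist q (fps_const e * fps_X ^ a * dilate (q ^ b) f) =
     fps_const (q ^ (a choose 2) * e) * fps_X ^ a * dilate (q ^ (a + b)) (triangular_twist q f)"
proof (rule fps_ext)
  fix n
  show "triangular_twist q (fps_const e * fps_X ^ a * dilate (q ^ b) f) $ n =
      (fps_const (q ^ (a choose 2) * e) * fps_X ^ a * dilate (q ^ (a + b)) (triangular_twist q f)) $ n"
  proof (cases "a \<le> n")
    case True
    then obtain m where n: "n = m + a"
      by (metis le_add_diff_inverse2)
    have "((m + a) choose 2) + b * m = (a choose 2) + ((a + b) * m + (m choose 2))"
      by (simp add: choose_two_add algebra_simps)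
    then have "q ^ ((m + a) choose 2) * (q ^ b) ^ m =
        q ^ (a choose 2) * ((q ^ (a + b)) ^ m * q ^ (m choose 2))"
      by (metis power_add power_mult)
    then have "q ^ ((m + a) choose 2) * (q ^ b) ^ m * (e * f $ m) =
        q ^ (a choose 2) * ((q ^ (a + b)) ^ m * q ^ (m choose 2)) * (e * f $ m)"
      by (rule arg_cong)
    then show ?thesis
      by (simp add: n mult.assoc fps_X_power_mult_nth del: power_mult)
         (simp only: mult.assoc mult.left_commute)
  qed (simp add: mult.assoc fps_X_power_mult_nth)
qed

text \<open>The monomials record sum and length of the openings \<open>[2]\<close>,
  \<open>[2,2]\<close>, \<open>[2,3]\<close>, \<open>[2,3,3]\<close>, \<open>[2,3,4]\<close> and,
  with a minus sign, \<open>[2,3,3,5,5]\<close>. Dilation by \<open>q ^ m\<close> stands for a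
  remainder with parts at least \<open>2 + m\<close>.\<close>

definition solves_q_difference :: "'a::comm_ring_1 \<Rightarrow> 'a fps \<Rightarrow> bool" where
  "solves_q_difference q F \<longleftrightarrow>
     F = dilate q F
       + (fps_const (q ^ 2) * fps_X + fps_const (q ^ 4) * fps_X ^ 2) * dilate (q ^ 2) F
       + (fps_const (q ^ 5) * fps_X ^ 2 + fps_const (q ^ 8) * fps_X ^ 3) * dilate (q ^ 3) F
       + fps_const (q ^ 9) * fps_X ^ 3 * dilate (q ^ 4) F
       - fps_const (q ^ 18) * fps_X ^ 5 * dilate (q ^ 5) F"

text \<open>The coefficient of index \<open>n\<close> carries the factor \<open>1 - q ^ n\<close>,
  which cancels in a domain; all other coefficients involved have smaller index.\<close>

lemma solves_q_difference_unique:
  fixes q :: "'a::idom"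
  assumes F: "solves_q_difference q F" and G: "solves_q_difference q G"
    and nth_0: "F $ 0 = G $ 0" and q: "\<And>n. n > 0 \<Longrightarrow> q ^ n \<noteq> 1"
  shows "F = G"
proof (rule fps_ext)
  fix n
  \<comment> \<open>Everything except the first dilation. The guards matter: truncated subtraction
    would otherwise read \<open>H $ 0\<close>.\<close>
  define lower where "lower H n =
        (if n < 1 then 0 else q ^ 2 * ((q ^ 2) ^ (n - 1) * H $ (n - 1)))
      + (if n < 2 then 0 else q ^ 4 * ((q ^ 2) ^ (n - 2) * H $ (n - 2)))
      + (if n < 2 then 0 else q ^ 5 * ((q ^ 3) ^ (n - 2) * H $ (n - 2)))
      + (if n < 3 then 0 else q ^ 8 * ((q ^ 3) ^ (n - 3) * H $ (n - 3)))
      + (if n < 3 then 0 else q ^ 9 * ((q ^ 4) ^ (n - 3) * H $ (n - 3)))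
      - (if n < 5 then 0 else q ^ 18 * ((q ^ 5) ^ (n - 5) * H $ (n - 5)))" for H n
  have rec: "H $ n = q ^ n * H $ n + lower H n" if "solves_q_difference q H" for H n
    by (subst that[unfolded solves_q_difference_def])
       (simp add: lower_def distrib_right mult.assoc fps_X_power_mult_nth)
  show "F $ n = G $ n"
  proof (induction n rule: less_induct)
    case (less n)
    show ?case
    proof (cases "n = 0")
      case True
      with nth_0 show ?thesis by simp
    next
      case False
      then have "lower F n = lower G n"
        by (simp add: lower_def less.IH)
      then have "F $ n - q ^ n * F $ n = G $ n - q ^ n * G $ n"
        using rec[OF F, of n] rec[OF G, of n] by (metis add_diff_cancel_left')
      then have "(1 - q ^ n) * (F $ n - G $ n) = 0"
        by (simp add: algebra_simps)
      with q[of n] False show ?thesis by simp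
    qed
  qed
qed

lemma triangular_twist_solves_q_difference:
  fixes q :: "'a::comm_ring_1" and G :: "'a fps"
  defines "Q \<equiv> fps_const q" and "Z \<equiv> fps_X"
  assumes G: "dilate q G * ((1 + Q ^ 2 * Z) * (1 + Q ^ 4 * Z ^ 2)) =
                G * ((1 - Q ^ 3 * Z ^ 2) * (1 - Q ^ 5 * Z ^ 3))"
  shows "solves_q_difference q (triangular_twist q G)"
proof -
  define mon where "mon e a b = fps_const (q ^ e) * fps_X ^ a * dilate (q ^ b) G" for e a b
  have mon: "triangular_twist q (mon e a b) =
      fps_const (q ^ ((a choose 2) + e)) * fps_X ^ a * dilate (q ^ (a + b)) (triangular_twist q G)"
    for e a b
    unfolding mon_def by (simp add: triangular_twist_monom_mult_dilate power_add)
  have dilate_1: "dilate 1 f = f" for f :: "'a fps"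
    by (rule fps_ext) simp
  \<comment> \<open>Both products are expanded and the equation is solved for \<open>G\<close>.
    Terms are grouped by \<open>a + b\<close>, the dilation exponent after the twist.\<close>
  have "G = mon 0 0 1 + (mon 2 1 1 + mon 3 2 0) + (mon 4 2 1 + mon 5 3 0) + mon 6 3 1 - mon 8 5 0"
    using G unfolding mon_def Q_def Z_def
    by (simp add: dilate_1 algebra_simps flip: power_add)
       (simp add: power_numeral_reduce algebra_simps flip: power_add fps_const_mult)
  then have "triangular_twist q G = triangular_twist q (mon 0 0 1 + (mon 2 1 1 + mon 3 2 0)
      + (mon 4 2 1 + mon 5 3 0) + mon 6 3 1 - mon 8 5 0)"
    by (rule arg_cong)
  then show ?thesis
    unfolding solves_q_difference_def triangular_twist_add triangular_twist_diff mon
    by (simp add: choose_two algebra_simps power2_eq_square power3_eq_cube)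
qed

subsection \<open>Weighted sums and their products\<close>

text \<open>The index type is arbitrary so that products can be indexed by pairs. A sum over an
  infinite fibre is 0 by convention, whence the finiteness assumptions for products.\<close>

definition weighted_series :: "('i \<Rightarrow> nat) \<Rightarrow> ('i \<Rightarrow> 'a::comm_ring_1) \<Rightarrow> 'a fps" where
  "weighted_series w f = Abs_fps (\<lambda>n. \<Sum>a | w a = n. f a)"

lemma weighted_series_mult:
  assumes "\<And>n. finite {a. w a = n}" and "\<And>n. finite {b. v b = n}"
  shows "weighted_series w f * weighted_series v g =
           weighted_series (\<lambda>(a, b). w a + v b) (\<lambda>(a, b). f a * g b)"
proof (rule fps_ext)
  fix n
  have "(\<Sum>x | (case x of (a, b) \<Rightarrow> w a + v b) = n. case x of (a, b) \<Rightarrow> f a * g b) =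
        (\<Sum>x \<in> (\<Union>i\<in>{0..n}. {a. w a = i} \<times> {b. v b = n - i}). case x of (a, b) \<Rightarrow> f a * g b)"
    by (rule sum.cong) auto
  also have "\<dots> = (\<Sum>i=0..n. \<Sum>x\<in>{a. w a = i} \<times> {b. v b = n - i}. case x of (a, b) \<Rightarrow> f a * g b)"
    by (rule sum.UNION_disjoint) (use assms in auto)
  also have "\<dots> = (\<Sum>i=0..n. (\<Sum>a | w a = i. f a) * (\<Sum>b | v b = n - i. g b))"
    by (simp add: sum_product sum.cartesian_product)
  finally show "(weighted_series w f * weighted_series v g) $ n =
      weighted_series (\<lambda>(a, b). w a + v b) (\<lambda>(a, b). f a * g b) $ n"
    by (simp add: weighted_series_def fps_mult_nth)
qed

lemma weighted_series_mult_nat_nth: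
  assumes "m > 0"
  shows "weighted_series ((*) m) b $ n = (if m dvd n then b (n div m) else 0)"
proof -
  have "{j. m * j = n} = (if m dvd n then {n div m} else {})"
    using assms by auto
  then show ?thesis
    by (simp add: weighted_series_def)
qed

text \<open>Subtracting the dilation multiplies the coefficient at exponent \<open>m * j\<close> by
  \<open>1 - q ^ (m * j)\<close>, so a recurrence for the coefficients becomes a functional
  equation. The sequence \<open>c\<close> may differ from \<open>b\<close>, as the alternating
  factor of the multisum requires.\<close>

lemma dilate_weighted_series_mult_nat:
  fixes b c :: "nat \<Rightarrow> 'a::comm_ring_1"
  assumes "m > 0" and "\<And>j. b (Suc j) * (1 - q ^ (m * Suc j)) = e * c j"
  shows "weighted_series ((*) m) b - dilate q (weighted_series ((*) m) b) =
           fps_const e * fps_X ^ m * weighted_series ((*) m) c"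
proof (rule fps_ext)
  fix n
  show "(weighted_series ((*) m) b - dilate q (weighted_series ((*) m) b)) $ n =
           (fps_const e * fps_X ^ m * weighted_series ((*) m) c) $ n"
  proof (cases "m dvd n")
    case False
    then show ?thesis
      using assms(1) by (auto simp: weighted_series_mult_nat_nth mult.assoc fps_X_power_mult_nth dvd_minus_self)
  next
    case True
    then obtain j where n: "n = m * j" ..
    show ?thesis
    proof (cases j)
      case 0
      with n assms(1) show ?thesis
        by (simp add: weighted_series_mult_nat_nth mult.assoc fps_X_power_mult_nth)
    next
      case (Suc i)
      have "b j * (1 - q ^ n) = e * c i"
        using assms(2)[of i] by (simp add: n Suc)
      moreover have "n - m = m * i" "\<not> n < m"
        by (simp_all add: n Suc)
      ultimately show ?thesis
        using assms(1) by (simp add: weighted_series_mult_nat_nth mult.assoc fps_X_power_mult_nth n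
            algebra_simps del: fps_mult_left_const_nth add: fps_mult_left_const_nth)
    qed
  qed
qed

subsection \<open>The generating function of the partitions\<close>

text \<open>Allowing \<open>i = 0\<close> makes the condition invariant under raising all parts by
  one.\<close>

definition pattern_free :: "nat list \<Rightarrow> bool" where
  "pattern_free p \<longleftrightarrow>
     (\<forall>i. \<not> sublist [i, i, i] p \<and> \<not> sublist [i, i, i + 1] p \<and>
          \<not> sublist [i, i + 1, i + 2, i + 2] p \<and> \<not> sublist [i, i + 1, i + 2, i + 3] p \<and>
          \<not> sublist [i, i + 1, i + 1, i + 3, i + 3] p)"

lemma pattern_free_Nil [simp]: "pattern_free []"
  by (simp add: pattern_free_def)

text \<open>An occurrence in \<open>x # p\<close> that does not lie in \<open>p\<close> begins at
  \<open>x\<close>, so only prefixes of \<open>p\<close> remain to be inspected.\<close>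

lemma pattern_free_Cons:
  "pattern_free (x # p) \<longleftrightarrow>
     pattern_free p \<and> \<not> prefix [x, x] p \<and> \<not> prefix [x, x + 1] p \<and>
     \<not> prefix [x + 1, x + 2, x + 2] p \<and> \<not> prefix [x + 1, x + 2, x + 3] p \<and>
     \<not> prefix [x + 1, x + 1, x + 3, x + 3] p"
  unfolding pattern_free_def sublist_Cons_right Cons_prefix_Cons all_conj_distrib de_Morgan_disj
  by auto

lemma prefix_map_Suc_iff: "prefix (map Suc v) (map Suc w) \<longleftrightarrow> prefix v w"
proof (induction v arbitrary: w)
  case (Cons a v)
  then show ?case by (cases w) auto
qed simp

lemma pattern_free_map_Suc: "pattern_free (map Suc p) \<longleftrightarrow> pattern_free p"
proof (induction p)
  case (Cons x p)
  then show ?case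
    using prefix_map_Suc_iff[of "[x, x]" p] prefix_map_Suc_iff[of "[x, x + 1]" p]
      prefix_map_Suc_iff[of "[x + 1, x + 2, x + 2]" p] prefix_map_Suc_iff[of "[x + 1, x + 2, x + 3]" p]
      prefix_map_Suc_iff[of "[x + 1, x + 1, x + 3, x + 3]" p]
    by (simp add: pattern_free_Cons)
qed simp

definition pattern_free_from :: "nat \<Rightarrow> nat list set" where
  "pattern_free_from k = {p. sorted p \<and> (\<forall>a\<in>set p. k \<le> a) \<and> pattern_free p}"

lemma Nil_in_pattern_free_from [simp]: "[] \<in> pattern_free_from k"
  by (simp add: pattern_free_from_def)

lemma Cons_in_pattern_free_from:
  "x # p \<in> pattern_free_from k \<longleftrightarrow> k \<le> x \<and> p \<in> pattern_free_from x \<and> pattern_free (x # p)"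
  by (auto simp: pattern_free_from_def pattern_free_Cons)

text \<open>Positive parts other than 1 are parts at least 2, and every pattern with
  \<open>i = 0\<close> contains the part 0.\<close>

lemma restricted_partitions_eq: "restricted_partitions = pattern_free_from 2"
proof (rule set_eqI)
  fix p :: "nat list"
  have "2 \<le> a \<longleftrightarrow> 0 < a \<and> a \<noteq> 1" for a :: nat
    by auto
  then have ge_2: "(\<forall>a\<in>set p. 2 \<le> a) \<longleftrightarrow> (\<forall>a\<in>set p. 0 < a) \<and> 1 \<notin> set p"
    by auto
  have "\<not> sublist (0 # w) p" if "\<forall>a\<in>set p. 0 < a" for w
    using that set_mono_sublist[of "0 # w" p] by force
  then have pos: "pattern_free p \<longleftrightarrow> (\<forall>i>0. \<not> sublist [i, i, i] p \<and> \<not> sublist [i, i, i + 1] p \<and>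
          \<not> sublist [i, i + 1, i + 2, i + 2] p \<and> \<not> sublist [i, i + 1, i + 2, i + 3] p \<and>
          \<not> sublist [i, i + 1, i + 1, i + 3, i + 3] p)" if "\<forall>a\<in>set p. 0 < a"
    unfolding pattern_free_def using that by (intro all_cong1) (metis gr0I)
  show "p \<in> restricted_partitions \<longleftrightarrow> p \<in> pattern_free_from 2"
    unfolding restricted_partitions_def pattern_free_from_def is_partition_def mem_Collect_eq ge_2
    using pos by blast
qed

lemma pattern_free_from_Suc: "pattern_free_from (Suc k) = map Suc ` pattern_free_from k"
proof (intro subset_antisym subsetI)
  fix p assume p: "p \<in> pattern_free_from (Suc k)"
  then have "map Suc (map (\<lambda>a. a - 1) p) = p"
    by (auto simp: pattern_free_from_def intro!: map_idI)
  moreover from this have "map (\<lambda>a. a - 1) p \<in> pattern_free_from k"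
    using p pattern_free_map_Suc[of "map (\<lambda>a. a - 1) p"]
    by (auto simp: pattern_free_from_def sorted_map intro: sorted_wrt_mono_rel[of _ "(\<le>)"])
  ultimately show "p \<in> map Suc ` pattern_free_from k"
    by (metis imageI)
next
  fix p assume "p \<in> map Suc ` pattern_free_from k"
  then show "p \<in> pattern_free_from (Suc k)"
    by (auto simp: pattern_free_from_def pattern_free_map_Suc sorted_map)
qed

lemma pattern_free_from_mono: "k \<le> l \<Longrightarrow> pattern_free_from l \<subseteq> pattern_free_from k"
  by (auto simp: pattern_free_from_def)

text \<open>
  The lists \<open>[2,3,3] @ p\<close> are all admissible except for those with \<open>p = [5,5] @ r\<close>; adding the
  latter on the left avoids a further set of partitions.
\<close>

lemma pattern_free_from_2_decomposition:
  defines "P \<equiv> pattern_free_from"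
  shows "P 2 \<union> (\<lambda>p. [2,3,3,5,5] @ p) ` P 7 =
     P 3 \<union> (\<lambda>p. [2] @ p) ` P 4 \<union> (\<lambda>p. [2,2] @ p) ` P 4 \<union> (\<lambda>p. [2,3] @ p) ` P 5 \<union>
     (\<lambda>p. [2,3,3] @ p) ` P 5 \<union> (\<lambda>p. [2,3,4] @ p) ` P 6" (is "?L = ?R")
proof (intro subset_antisym subsetI)
  have from_cases: "p = [] \<or> (\<exists>r. p = k # r) \<or> p \<in> P (Suc k)" if "p \<in> P k" for p k
    using that unfolding P_def
    by (cases p) (auto simp: Cons_in_pattern_free_from)
  fix p
  {
    assume "p \<in> ?R"
    then consider "p \<in> P 3" | r where "p = [2] @ r" "r \<in> P 4" | r where "p = [2,2] @ r" "r \<in> P 4"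
      | r where "p = [2,3] @ r" "r \<in> P 5" | r where "p = [2,3,3] @ r" "r \<in> P 5"
      | r where "p = [2,3,4] @ r" "r \<in> P 6"
      by blast
    then show "p \<in> ?L"
    proof cases
      case 1
      then show ?thesis
        using pattern_free_from_mono[of 2 3] by (auto simp: P_def)
    next
      case (2 r)
      then show ?thesis
        by (cases r) (auto simp: P_def Cons_in_pattern_free_from pattern_free_Cons)
    next
      case (3 r)
      then show ?thesis
        by (cases r) (auto simp: P_def Cons_in_pattern_free_from pattern_free_Cons)
    next
      case (4 r)
      then show ?thesis
        by (cases r) (auto simp: P_def Cons_in_pattern_free_from pattern_free_Cons)
    next
      case (5 r)
      \<comment> \<open>Only \<open>[2,3,3,5,5]\<close> can straddle \<open>[2,3,3]\<close> and a
        remainder with parts at least 5. If it occurs, the bans on \<open>[5,5,5]\<close> and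
        \<open>[5,5,6]\<close> push the later parts to at least 7.\<close>
      show ?thesis
      proof (cases "\<exists>s. r = [5, 5] @ s")
        case True
        then obtain s where r: "r = [5, 5] @ s" ..
        then have "s \<in> P 7"
          using 5 by (cases s) (auto simp: P_def Cons_in_pattern_free_from pattern_free_Cons)
        with 5 r show ?thesis by simp
      next
        case False
        with 5 have "p \<in> P 2"
          by (cases r; cases "tl r") (auto simp: P_def Cons_in_pattern_free_from pattern_free_Cons)
        then show ?thesis by simp
      qed
    next
      case (6 r)
      then show ?thesis
        by (cases r) (auto simp: P_def Cons_in_pattern_free_from pattern_free_Cons)
    qed
  }
  {
    assume "p \<in> ?L"
    then consider "p \<in> P 3" | "p = []" | r where "p = 2 # r" "p \<in> P 2"
       | r where "p = [2,3,3,5,5] @ r" "r \<in> P 7"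
      using from_cases[of p 2] by auto
    then show "p \<in> ?R"
    proof cases
      case (3 r)
      note p = this
      show ?thesis
      proof (cases r)
        case Nil
        with p show ?thesis by (auto simp: P_def)
      next
        case (Cons y s)
        then consider "y = 2" | "y = 3" | "y \<ge> 4"
          using p by (fastforce simp: P_def Cons_in_pattern_free_from)
        then show ?thesis
        proof cases
          case 1
          \<comment> \<open>\<open>[2,2,2]\<close> and \<open>[2,2,3]\<close> are forbidden.\<close>
          with p Cons have "s \<in> P 4"
            by (cases s) (auto simp: P_def Cons_in_pattern_free_from pattern_free_Cons)
          with 1 p Cons show ?thesis by auto
        next
          case 2
          show ?thesis
          proof (cases s)
            case Nil
            with p Cons 2 show ?thesis by (auto simp: P_def)
          next
            case s: (Cons z t)
            then consider "z = 3" | "z = 4" | "z \<ge> 5"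
              using p Cons 2 by (fastforce simp: P_def Cons_in_pattern_free_from)
            then show ?thesis
            proof cases
              case 1
              \<comment> \<open>\<open>[3,3,3]\<close> and \<open>[3,3,4]\<close> are
                forbidden.\<close>
              with p Cons 2 s have "t \<in> P 5"
                by (cases t) (auto simp: P_def Cons_in_pattern_free_from pattern_free_Cons)
              with 1 2 p Cons s show ?thesis by auto
            next
              case z: 2
              \<comment> \<open>\<open>[2,3,4,4]\<close> and \<open>[2,3,4,5]\<close> are
                forbidden.\<close>
              with p Cons 2 s have "t \<in> P 6"
                by (cases t) (auto simp: P_def Cons_in_pattern_free_from pattern_free_Cons)
              with z 2 p Cons s show ?thesis by auto
            next
              case 3
              with p Cons 2 s have "s \<in> P 5"
                by (auto simp: P_def Cons_in_pattern_free_from pattern_free_Cons)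
              with 2 p Cons show ?thesis by auto
            qed
          qed
        next
          case 3
          with p Cons have "r \<in> P 4"
            by (auto simp: P_def Cons_in_pattern_free_from pattern_free_Cons)
          with p show ?thesis by auto
        qed
      qed
    next
      case (4 r)
      \<comment> \<open>Prepending \<open>[5,5]\<close> to parts at least 7 creates no forbidden
        pattern, so the added lists also arise from the opening \<open>[2,3,3]\<close>.\<close>
      then have "[5, 5] @ r \<in> P 5"
        by (cases r) (auto simp: P_def Cons_in_pattern_free_from pattern_free_Cons)
      with 4 show ?thesis by force
    qed (auto simp: P_def)
  }
qed

text \<open>A series in x over series in q, the opposite nesting to \<open>xvar\<close> and
  \<open>qvar\<close>, so that replacing x by xq is a dilation of the outer variable.\<close>

definition list_gf :: "nat list set \<Rightarrow> rat fps fps" where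
  "list_gf S = Abs_fps (\<lambda>n. Abs_fps (\<lambda>N. of_nat (card {p \<in> S. length p = n \<and> sum_list p = N})))"

lemma finite_length_sum: "finite {p \<in> S. length p = n \<and> sum_list p = (N :: nat)}"
proof (rule finite_subset)
  show "{p \<in> S. length p = n \<and> sum_list p = N} \<subseteq> {p. set p \<subseteq> {..N} \<and> length p = n}"
    using member_le_sum_list by fastforce
qed (simp add: finite_lists_length_eq)

lemma list_gf_Un:
  assumes "S \<inter> T = {}"
  shows "list_gf (S \<union> T) = list_gf S + list_gf T"
proof (intro fps_ext)
  fix n N
  have "{p \<in> S \<union> T. length p = n \<and> sum_list p = N} =
          {p \<in> S. length p = n \<and> sum_list p = N} \<union> {p \<in> T. length p = n \<and> sum_list p = N}"
    by auto
  moreover have "card \<dots> = card {p \<in> S. length p = n \<and> sum_list p = N} +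
                            card {p \<in> T. length p = n \<and> sum_list p = N}"
    by (rule card_Un_disjoint) (use assms finite_length_sum in auto)
  ultimately show "list_gf (S \<union> T) $ n $ N = (list_gf S + list_gf T) $ n $ N"
    by (simp add: list_gf_def)
qed

lemma list_gf_append:
  "list_gf ((@) w ` S) =
     fps_const (fps_X ^ sum_list w) * fps_X ^ length w * list_gf S"
proof (intro fps_ext)
  fix n N
  have "{p \<in> (@) w ` S. length p = n \<and> sum_list p = N} =
          (if n < length w \<or> N < sum_list w then {}
           else (@) w ` {p \<in> S. length p = n - length w \<and> sum_list p = N - sum_list w})"
    by auto
  then have "card {p \<in> (@) w ` S. length p = n \<and> sum_list p = N} =
          (if n < length w \<or> N < sum_list w then 0
           else card {p \<in> S. length p = n - length w \<and> sum_list p = N - sum_list w})"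
    by (simp add: card_image inj_on_def)
  then show "list_gf ((@) w ` S) $ n $ N =
      (fps_const (fps_X ^ sum_list w) * fps_X ^ length w * list_gf S) $ n $ N"
    by (simp add: list_gf_def mult.assoc fps_X_power_mult_nth)
qed

lemma list_gf_map_Suc: "list_gf (map Suc ` S) = dilate fps_X (list_gf S)"
proof (intro fps_ext)
  fix n N
  have sum: "sum_list (map Suc p) = sum_list p + length p" for p
    by (induction p) auto
  have "{p \<in> map Suc ` S. length p = n \<and> sum_list p = N} =
          (if N < n then {} else map Suc ` {p \<in> S. length p = n \<and> sum_list p = N - n})"
    by (auto simp: sum)
  then have "card {p \<in> map Suc ` S. length p = n \<and> sum_list p = N} =
          (if N < n then 0 else card {p \<in> S. length p = n \<and> sum_list p = N - n})"
    by (simp add: card_image inj_on_subset[OF inj_mapI])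
  then show "list_gf (map Suc ` S) $ n $ N = dilate fps_X (list_gf S) $ n $ N"
    by (simp add: list_gf_def fps_X_power_mult_nth)
qed

lemma list_gf_pattern_free_from:
  "list_gf (pattern_free_from (k + m)) = dilate (fps_X ^ m) (list_gf (pattern_free_from k))"
proof (induction m)
  case 0
  show ?case by (rule fps_ext) simp
qed (simp add: pattern_free_from_Suc list_gf_map_Suc dilate_dilate)

lemma list_gf_restricted_partitions_nth_0: "list_gf restricted_partitions $ 0 = 1"
proof (rule fps_ext)
  fix N :: nat
  have "{p \<in> restricted_partitions. length p = 0 \<and> sum_list p = N} = (if N = 0 then {[]} else {})"
    by (auto simp: restricted_partitions_eq)
  then show "list_gf restricted_partitions $ 0 $ N = 1 $ N"
    by (simp add: list_gf_def)
qed

lemma restricted_partitions_solve_q_difference: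
  "solves_q_difference fps_X (list_gf restricted_partitions)"
proof -
  define P where "P = pattern_free_from"
  define F where "F = list_gf (P 2)"
  have shift: "list_gf (P (2 + m)) = dilate (fps_X ^ m) F" for m
    unfolding F_def P_def by (rule list_gf_pattern_free_from)
  have "list_gf (P 2 \<union> (@) [2,3,3,5,5] ` P 7) =
        list_gf (P 3 \<union> (@) [2] ` P 4 \<union> (@) [2,2] ` P 4 \<union> (@) [2,3] ` P 5 \<union> (@) [2,3,3] ` P 5 \<union>
                 (@) [2,3,4] ` P 6)"
    unfolding P_def pattern_free_from_2_decomposition ..
  \<comment> \<open>Disjoint because the added lists themselves begin with a forbidden
    pattern.\<close>
  also have "list_gf (P 2 \<union> (@) [2,3,3,5,5] ` P 7) = list_gf (P 2) + list_gf ((@) [2,3,3,5,5] ` P 7)"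
    by (rule list_gf_Un) (auto simp: P_def Cons_in_pattern_free_from pattern_free_Cons)
  \<comment> \<open>Disjointness is read off the leading parts: each remainder starts above any part
    that would continue to a longer opening.\<close>
  also have "list_gf (P 3 \<union> (@) [2] ` P 4 \<union> (@) [2,2] ` P 4 \<union> (@) [2,3] ` P 5 \<union> (@) [2,3,3] ` P 5 \<union>
                 (@) [2,3,4] ` P 6) =
      list_gf (P 3) + list_gf ((@) [2] ` P 4) + list_gf ((@) [2,2] ` P 4) + list_gf ((@) [2,3] ` P 5)
      + list_gf ((@) [2,3,3] ` P 5) + list_gf ((@) [2,3,4] ` P 6)"
    by (subst list_gf_Un, force simp: P_def Cons_in_pattern_free_from)+ simp
  finally have "F = dilate (fps_X ^ 1) F
       + fps_const (fps_X ^ 2) * fps_X ^ 1 * dilate (fps_X ^ 2) F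
       + fps_const (fps_X ^ 4) * fps_X ^ 2 * dilate (fps_X ^ 2) F
       + fps_const (fps_X ^ 5) * fps_X ^ 2 * dilate (fps_X ^ 3) F
       + fps_const (fps_X ^ 8) * fps_X ^ 3 * dilate (fps_X ^ 3) F
       + fps_const (fps_X ^ 9) * fps_X ^ 3 * dilate (fps_X ^ 4) F
       - fps_const (fps_X ^ 18) * fps_X ^ 5 * dilate (fps_X ^ 5) F"
    using shift[of 1] shift[of 2] shift[of 3] shift[of 4] shift[of 5]
    unfolding list_gf_append
    by (simp add: F_def[symmetric] eq_diff_eq add_ac numeral_3_eq_3[symmetric] power_numeral_reduce)
  then show ?thesis
    unfolding solves_q_difference_def restricted_partitions_eq F_def P_def
    by (simp add: algebra_simps)
qed

subsection \<open>The multisum\<close>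

lemma qpochhammer_nth_0:
  fixes a q :: "'a::comm_ring_1 fps"
  assumes "a $ 0 = 0"
  shows "qpochhammer a q n $ 0 = 1"
  unfolding qpochhammer_def by (induction n) (simp_all add: assms)

lemma inverse_qpochhammer_Suc:
  fixes q :: "rat fps"
  assumes "q $ 0 = 0" and "m > 0"
  shows "inverse (qpochhammer (q ^ m) (q ^ m) (Suc j)) * (1 - q ^ (m * Suc j)) =
           inverse (qpochhammer (q ^ m) (q ^ m) j)"
proof -
  have "qpochhammer (q ^ m) (q ^ m) (Suc j) = qpochhammer (q ^ m) (q ^ m) j * (1 - q ^ (m * Suc j))"
    by (simp add: qpochhammer_def power_add power_mult)
  moreover have "(1 - q ^ (m * Suc j)) $ 0 \<noteq> 0"
    using assms by (simp add: fps_power_zeroth power_0_left)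
  ultimately show ?thesis
    by (simp add: fps_inverse_mult mult.assoc inverse_mult_eq_1)
qed

definition multisum_weight :: "nat \<times> nat \<times> nat \<times> nat \<Rightarrow> nat" where
  "multisum_weight = (\<lambda>(i, j, k, l). i + 2 * j + 3 * k + 4 * l)"

definition multisum_coeff :: "nat \<times> nat \<times> nat \<times> nat \<Rightarrow> rat fps" where
  "multisum_coeff = (\<lambda>(i, j, k, l).
     (- 1) ^ l * fps_X ^ (2 * l\<^sup>2 + 2 * i + 3 * j + 5 * k + 6 * l)
     * inverse (qpochhammer fps_X fps_X i * qpochhammer (fps_X ^ 2) (fps_X ^ 2) j *
            qpochhammer (fps_X ^ 3) (fps_X ^ 3) k * qpochhammer (fps_X ^ 4) (fps_X ^ 4) l))"

lemma finite_fibre_mult_nat: "m > 0 \<Longrightarrow> finite {j :: nat. m * j = n}"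
  by (rule finite_subset[of _ "{..n}"]) auto

lemma finite_fibre_add:
  assumes "\<And>n. finite {a. w a = n}" and "\<And>n. finite {b. v b = n}"
  shows "finite {x. (case x of (a, b) \<Rightarrow> w a + v b) = (n::nat)}"
proof (rule finite_subset)
  show "{x. (case x of (a, b) \<Rightarrow> w a + v b) = n} \<subseteq> (\<Union>i\<in>{0..n}. {a. w a = i} \<times> {b. v b = n - i})"
    by auto
qed (use assms in auto)

lemma multisum_solves_q_difference:
  "solves_q_difference fps_X (triangular_twist fps_X (weighted_series multisum_weight multisum_coeff))"
proof -
  define q :: "rat fps" where "q = fps_X"
  have q0: "q $ 0 = 0" by (simp add: q_def)
  \<comment> \<open>Euler's sums: \<open>b m e\<close> yields \<open>1/(z^m q^e; q^m)\<close> and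
    \<open>d\<close> yields \<open>(z^4 q^8; q^4)\<close>, as infinite products. Only their
    functional equations are used.\<close>
  define b where "b m e j = q ^ (e * j) * inverse (qpochhammer (q ^ m) (q ^ m) j)" for m e j :: nat
  define d where "d l = (- 1) ^ l * q ^ (2 * l\<^sup>2 + 6 * l) * inverse (qpochhammer (q ^ 4) (q ^ 4) l)" for l
  define A where "A = weighted_series ((*) 1) (b 1 2)"
  define B where "B = weighted_series ((*) 2) (b 2 3)"
  define C where "C = weighted_series ((*) 3) (b 3 5)"
  define D where "D = weighted_series ((*) 4) d"
  have b_rec: "b m e (Suc j) * (1 - q ^ (m * Suc j)) = q ^ e * b m e j" if "m > 0" for m e j
    unfolding b_def mult.assoc inverse_qpochhammer_Suc[OF q0 that] by (simp add: power_add mult_ac)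
  \<comment> \<open>Advancing \<open>l\<close> raises \<open>2 * l^2 + 6 * l\<close> by
    \<open>4 * l + 8\<close>; the extra \<open>q ^ (4 * l)\<close> is itself a dilation.\<close>
  have d_rec: "d (Suc l) * (1 - q ^ (4 * Suc l)) = - (q ^ 8) * (q ^ (4 * l) * d l)" for l
  proof -
    have "2 * (Suc l)\<^sup>2 + 6 * Suc l = 8 + (4 * l + (2 * l\<^sup>2 + 6 * l))"
      by (simp add: power2_eq_square)
    then show ?thesis
      unfolding d_def mult.assoc inverse_qpochhammer_Suc[OF q0 zero_less_numeral]
      by (simp only: power_add power_Suc) (simp add: mult_ac)
  qed
  have dilate_D: "weighted_series ((*) 4) (\<lambda>l. q ^ (4 * l) * d l) = dilate q D"
    by (rule fps_ext) (simp add: D_def weighted_series_mult_nat_nth)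
  let ?Q = "fps_const q" and ?Z = "fps_X :: rat fps fps"
  \<comment> \<open>Dilation strips the first factor of each infinite product. It sits in the
    denominator for \<open>A\<close>, \<open>B\<close>, \<open>C\<close> and in the numerator for
    \<open>D\<close>, whose equation is therefore reversed.\<close>
  have A: "dilate q A = (1 - ?Q ^ 2 * ?Z) * A"
    using dilate_weighted_series_mult_nat[of 1 "b 1 2" q "q ^ 2", OF _ b_rec]
    by (simp add: A_def algebra_simps)
  have B: "dilate q B = (1 - ?Q ^ 3 * ?Z ^ 2) * B"
    using dilate_weighted_series_mult_nat[of 2 "b 2 3" q "q ^ 3", OF _ b_rec]
    by (simp add: B_def algebra_simps)
  have C: "dilate q C = (1 - ?Q ^ 5 * ?Z ^ 3) * C"
    using dilate_weighted_series_mult_nat[of 3 "b 3 5" q "q ^ 5", OF _ b_rec]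
    by (simp add: C_def algebra_simps)
  have "D - dilate q D = fps_const (- (q ^ 8)) * ?Z ^ 4 * dilate q D"
    using dilate_weighted_series_mult_nat[of 4 d q, OF _ d_rec]
    unfolding dilate_D D_def[symmetric] by simp
  then have D: "D = (1 - ?Q ^ 8 * ?Z ^ 4) * dilate q D"
    by (simp add: algebra_simps flip: fps_const_neg)
  have "1 - ?Q ^ 8 * ?Z ^ 4 = (1 - ?Q ^ 2 * ?Z) * ((1 + ?Q ^ 2 * ?Z) * (1 + ?Q ^ 4 * ?Z ^ 2))"
    by algebra
  \<comment> \<open>The factor \<open>1 - Q^2 Z\<close> contributed by \<open>A\<close> completes
    the factorisation, and \<open>1 - Q^8 Z^4\<close> then turns \<open>dilate q D\<close> back into
    \<open>D\<close>.\<close>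
  then have "dilate q (A * (B * (C * D))) * ((1 + ?Q ^ 2 * ?Z) * (1 + ?Q ^ 4 * ?Z ^ 2)) =
          (A * (B * (C * ((1 - ?Q ^ 8 * ?Z ^ 4) * dilate q D)))) * ((1 - ?Q ^ 3 * ?Z ^ 2) * (1 - ?Q ^ 5 * ?Z ^ 3))"
    unfolding dilate_mult A B C by (simp only: mult_ac)
  then have "dilate q (A * (B * (C * D))) * ((1 + ?Q ^ 2 * ?Z) * (1 + ?Q ^ 4 * ?Z ^ 2)) =
          (A * (B * (C * D))) * ((1 - ?Q ^ 3 * ?Z ^ 2) * (1 - ?Q ^ 5 * ?Z ^ 3))"
    unfolding D[symmetric] .
  moreover have "A * (B * (C * D)) = weighted_series multisum_weight multisum_coeff"
  proof -
    have weight: "multisum_weight = (\<lambda>(i, j, k, l). i + (2 * j + (3 * k + 4 * l)))"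
      by (auto simp: multisum_weight_def)
    have coeff: "multisum_coeff = (\<lambda>(i, j, k, l). b 1 2 i * (b 2 3 j * (b 3 5 k * d l)))"
      by (auto simp: multisum_coeff_def b_def d_def q_def power_add fps_inverse_mult mult_ac)
    show ?thesis
      unfolding A_def B_def C_def D_def
      by (simp add: weighted_series_mult finite_fibre_mult_nat finite_fibre_add)
         (simp add: weight coeff case_prod_unfold)
  qed
  ultimately show ?thesis
    unfolding q_def by (intro triangular_twist_solves_q_difference) simp
qed

text \<open>Both sides solve the q-difference equation and have constant term 1.\<close>

lemma list_gf_restricted_partitions:
  "list_gf restricted_partitions =
     triangular_twist fps_X (weighted_series multisum_weight multisum_coeff)"
proof (rule solves_q_difference_unique[OF restricted_partitions_solve_q_difference
      multisum_solves_q_difference])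
  have "{t. multisum_weight t = 0} = {(0, 0, 0, 0)}"
    by (auto simp: multisum_weight_def)
  then show "list_gf restricted_partitions $ 0 =
      triangular_twist fps_X (weighted_series multisum_weight multisum_coeff) $ 0"
    by (simp add: list_gf_restricted_partitions_nth_0 weighted_series_def multisum_coeff_def
        choose_two qpochhammer_def)
  show "(fps_X :: rat fps) ^ n \<noteq> 1" if "n > 0" for n
    using that fps_X_power_nth[of n 0, where 'a = rat] by (metis fps_one_nth not_gr_zero zero_neq_one)
qed

subsection \<open>Interchanging the two variables\<close>

text \<open>Embeds series in q as series whose coefficients are constant in x, linking the two
  nestings of the variables.\<close>

definition lift_coeffs :: "'a::comm_ring_1 fps \<Rightarrow> 'a fps fps" where
  "lift_coeffs f = Abs_fps (\<lambda>n. fps_const (f $ n))"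

lemma lift_coeffs_mult: "lift_coeffs (f * g) = lift_coeffs f * lift_coeffs g"
proof (intro fps_ext)
  fix N n
  show "lift_coeffs (f * g) $ N $ n = (lift_coeffs f * lift_coeffs g) $ N $ n"
    by (simp add: lift_coeffs_def fps_mult_nth fps_sum_nth)
qed

lemma lift_coeffs_1 [simp]: "lift_coeffs 1 = 1"
  by (rule fps_ext) (simp add: lift_coeffs_def)

lemma lift_coeffs_diff: "lift_coeffs (f - g) = lift_coeffs f - lift_coeffs g"
  by (rule fps_ext) (simp add: lift_coeffs_def)

lemma lift_coeffs_uminus: "lift_coeffs (- f) = - lift_coeffs f"
  by (rule fps_ext) (simp add: lift_coeffs_def)

lemma lift_coeffs_power: "lift_coeffs (f ^ n) = lift_coeffs f ^ n"
  by (induction n) (simp_all add: lift_coeffs_mult)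

lemma lift_coeffs_X: "lift_coeffs fps_X = qvar"
  by (rule fps_ext) (simp add: lift_coeffs_def qvar_def)

lemma lift_coeffs_qpochhammer:
  "lift_coeffs (qpochhammer a q n) = qpochhammer (lift_coeffs a) (lift_coeffs q) n"
  unfolding qpochhammer_def
  by (induction n) (simp_all add: lift_coeffs_mult lift_coeffs_diff lift_coeffs_power)

text \<open>The coefficient ring is not a field, but the embedding preserves products, so the image
  of \<open>inverse g\<close> inverts the image of \<open>g\<close>, and inverses are
  unique.\<close>

lemma divide_lift_coeffs:
  fixes g :: "'a::field fps"
  assumes "g $ 0 \<noteq> 0"
  shows "f / lift_coeffs g = f * lift_coeffs (inverse g)"
proof -
  have "lift_coeffs g * lift_coeffs (inverse g) = 1"
    using assms by (simp add: inverse_mult_eq_1' flip: lift_coeffs_mult)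
  moreover have "lift_coeffs (inverse g) $ 0 * lift_coeffs g $ 0 = 1"
    using assms by (simp add: lift_coeffs_def)
  ultimately have "fps_right_inverse (lift_coeffs g) (lift_coeffs (inverse g) $ 0) = lift_coeffs (inverse g)"
    by (rule fps_lr_inverse_unique_ring1(2))
  moreover have "lift_coeffs (inverse g) $ 0 = inverse (lift_coeffs g $ 0)"
    by (simp add: lift_coeffs_def fps_const_inverse)
  ultimately have "inverse (lift_coeffs g) = lift_coeffs (inverse g)"
    by (simp add: fps_inverse_def)
  then show ?thesis
    using assms by (subst fps_divide_unit) (simp_all add: lift_coeffs_def)
qed

lemma multisum_term_eq:
  "multisum_term i j k l = xvar ^ multisum_weight (i, j, k, l) *
     lift_coeffs (fps_X ^ (multisum_weight (i, j, k, l) choose 2) * multisum_coeff (i, j, k, l))"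
proof -
  have "qpochhammer qvar qvar i * qpochhammer (qvar ^ 2) (qvar ^ 2) j *
          qpochhammer (qvar ^ 3) (qvar ^ 3) k * qpochhammer (qvar ^ 4) (qvar ^ 4) l =
        lift_coeffs (qpochhammer fps_X fps_X i * qpochhammer (fps_X ^ 2) (fps_X ^ 2) j *
          qpochhammer (fps_X ^ 3) (fps_X ^ 3) k * qpochhammer (fps_X ^ 4) (fps_X ^ 4) l)"
    by (simp add: lift_coeffs_mult lift_coeffs_qpochhammer lift_coeffs_power lift_coeffs_X)
  then show ?thesis
    unfolding multisum_term_def Let_def
    by (simp add: divide_lift_coeffs qpochhammer_nth_0 fps_power_zeroth)
       (simp add: multisum_weight_def multisum_coeff_def lift_coeffs_mult lift_coeffs_power
          lift_coeffs_uminus lift_coeffs_X choose_two power_add mult_ac)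
qed

section \<open>Coefficients and convergence of the two infinite sums\<close>

lemma xvar_power_mult_lift_coeffs_nth:
  "(xvar ^ m * lift_coeffs f) $ N $ n = (if n = m then f $ N else 0)"
  by (simp add: xvar_def lift_coeffs_def fps_X_power_mult_nth)

text \<open>Once a finite index set contains the finitely many indices that contribute to
  coefficient \<open>N\<close>, the partial sums no longer change there.\<close>

lemma fps_has_sum:
  fixes f :: "'i \<Rightarrow> 'a::comm_ring_1 fps"
  assumes "\<And>N. finite {a \<in> A. f a $ N \<noteq> 0}"
  shows "(f has_sum Abs_fps (\<lambda>N. \<Sum>a | a \<in> A \<and> f a $ N \<noteq> 0. f a $ N)) A"
  unfolding has_sum_def
proof (rule tendsto_fpsI)
  fix N
  show "\<forall>\<^sub>F X in finite_subsets_at_top A.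
          sum f X $ N = Abs_fps (\<lambda>N. \<Sum>a | a \<in> A \<and> f a $ N \<noteq> 0. f a $ N) $ N"
    unfolding eventually_finite_subsets_at_top
  proof (intro exI[of _ "{a \<in> A. f a $ N \<noteq> 0}"] conjI allI impI)
    fix Y assume Y: "finite Y \<and> {a \<in> A. f a $ N \<noteq> 0} \<subseteq> Y \<and> Y \<subseteq> A"
    then show "sum f Y $ N = Abs_fps (\<lambda>N. \<Sum>a | a \<in> A \<and> f a $ N \<noteq> 0. f a $ N) $ N"
      by (auto simp: fps_sum_nth intro!: sum.mono_neutral_right)
  qed (use assms in auto)
qed

text \<open>\<open>B\<close> need only contain the indices contributing at \<open>(N, n)\<close>; it
  can thus be chosen by the exponent of x, unlike the support at \<open>N\<close>.\<close>

lemma infsum_fps_fps_nth: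
  fixes f :: "'i \<Rightarrow> 'a::comm_ring_1 fps fps"
  assumes supp: "\<And>N. finite {a \<in> A. f a $ N \<noteq> 0}"
    and B: "finite B" "B \<subseteq> A" "\<And>a. a \<in> A - B \<Longrightarrow> f a $ N $ n = 0"
  shows "infsum f A $ N $ n = (\<Sum>a\<in>B. f a $ N $ n)"
proof -
  have "infsum f A $ N $ n = (\<Sum>a | a \<in> A \<and> f a $ N \<noteq> 0. f a $ N $ n)"
    by (simp add: infsumI[OF fps_has_sum[OF supp]] fps_sum_nth)
  also have "\<dots> = (\<Sum>a\<in>B. f a $ N $ n)"
    by (rule sum.mono_neutral_cong) (use supp B in auto)
  finally show ?thesis .
qed

lemma finite_multisum_support:
  "finite {t \<in> UNIV. (\<lambda>(i, j, k, l). multisum_term i j k l) t $ N \<noteq> 0}"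
proof (rule finite_subset)
  show "{t \<in> UNIV. (\<lambda>(i, j, k, l). multisum_term i j k l) t $ N \<noteq> 0} \<subseteq> {..N} \<times> {..N} \<times> {..N} \<times> {..N}"
  proof
    fix t assume "t \<in> {t \<in> UNIV. (\<lambda>(i, j, k, l). multisum_term i j k l) t $ N \<noteq> 0}"
    moreover obtain i j k l where t: "t = (i, j, k, l)"
      by (cases t)
    ultimately have "multisum_term i j k l $ N \<noteq> 0"
      by simp
    then obtain n where "multisum_term i j k l $ N $ n \<noteq> 0"
      by (auto simp: fps_eq_iff)
    then have "(fps_X ^ (multisum_weight (i, j, k, l) choose 2) * multisum_coeff (i, j, k, l)) $ N \<noteq> 0"
      unfolding multisum_term_eq xvar_power_mult_lift_coeffs_nth by (auto split: if_splits)
    then have "multisum_coeff (i, j, k, l) $ (N - (multisum_weight (i, j, k, l) choose 2)) \<noteq> 0"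
      by (auto simp: fps_X_power_mult_nth split: if_splits)
    \<comment> \<open>Keeping the cofactor opaque as \<open>r\<close> leaves only the power of q,
      whose exponent bounds each of the four indices.\<close>
    moreover have "multisum_coeff (i, j, k, l) = fps_X ^ (2 * l\<^sup>2 + 2 * i + 3 * j + 5 * k + 6 * l) * r"
      if "r = (- 1) ^ l * inverse (qpochhammer fps_X fps_X i * qpochhammer (fps_X ^ 2) (fps_X ^ 2) j *
            qpochhammer (fps_X ^ 3) (fps_X ^ 3) k * qpochhammer (fps_X ^ 4) (fps_X ^ 4) l)" for r
      by (simp add: multisum_coeff_def that mult_ac)
    ultimately have "2 * l\<^sup>2 + 2 * i + 3 * j + 5 * k + 6 * l \<le> N"
      by (auto simp: fps_X_power_mult_nth split: if_splits)
    then show "t \<in> {..N} \<times> {..N} \<times> {..N} \<times> {..N}"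
      by (simp add: t)
  qed
qed simp

lemma partition_monomial_nth:
  "(xvar ^ m * qvar ^ s) $ N $ n = (if n = m \<and> N = s then 1 else 0)"
  by (simp add: xvar_def qvar_def)

lemma finite_partition_support:
  "finite {p \<in> restricted_partitions. (xvar ^ length p * qvar ^ sum_list p) $ N \<noteq> 0}"
proof (rule finite_subset)
  show "{p \<in> restricted_partitions. (xvar ^ length p * qvar ^ sum_list p) $ N \<noteq> 0} \<subseteq>
          {p. set p \<subseteq> {..N} \<and> length p \<le> N}"
  proof (intro subsetI CollectI, elim CollectE conjE)
    fix p assume p: "p \<in> restricted_partitions"
      and "(xvar ^ length p * qvar ^ sum_list p) $ N \<noteq> 0"
    then obtain n where "(xvar ^ length p * qvar ^ sum_list p) $ N $ n \<noteq> 0"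
      by (auto simp: fps_eq_iff)
    then have sum: "sum_list p = N"
      unfolding partition_monomial_nth by (auto split: if_splits)
    have "length p \<le> sum_list p" if "\<forall>a\<in>set p. 2 \<le> a" for p :: "nat list"
      using that by (induction p) auto
    with p sum have "length p \<le> N"
      by (auto simp: restricted_partitions_eq pattern_free_from_def)
    with sum show "set p \<subseteq> {..N} \<and> length p \<le> N"
      using member_le_sum_list by fastforce
  qed
qed (simp add: finite_lists_length_le)

theorem mainTheorem11:
  shows "(\<lambda>p. xvar ^ length p * qvar ^ sum_list p) summable_on restricted_partitions \<and>
         (\<lambda>(i, j, k, l). multisum_term i j k l) summable_on UNIV \<and>
         (\<Sum>\<^sub>\<infinity>p\<in>restricted_partitions. xvar ^ length p * qvar ^ sum_list p)
           = (\<Sum>\<^sub>\<infinity>(i, j, k, l). multisum_term i j k l)"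
proof (intro conjI)
  show "(\<lambda>p. xvar ^ length p * qvar ^ sum_list p) summable_on restricted_partitions"
    by (rule has_sum_imp_summable[OF fps_has_sum]) (rule finite_partition_support)
  show "(\<lambda>(i, j, k, l). multisum_term i j k l) summable_on UNIV"
    by (rule has_sum_imp_summable[OF fps_has_sum]) (rule finite_multisum_support)
  show "(\<Sum>\<^sub>\<infinity>p\<in>restricted_partitions. xvar ^ length p * qvar ^ sum_list p)
           = (\<Sum>\<^sub>\<infinity>(i, j, k, l). multisum_term i j k l)"
  proof (intro fps_ext)
    fix N n
    let ?P = "{p \<in> restricted_partitions. length p = n \<and> sum_list p = N}"
    let ?T = "{t. multisum_weight t = n}"
    have T: "finite ?T"
      by (rule finite_subset[of _ "{..n} \<times> {..n} \<times> {..n} \<times> {..n}"]) (auto simp: multisum_weight_def)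
    have term_nth: "(\<lambda>(i, j, k, l). multisum_term i j k l) t $ N $ n =
        (if multisum_weight t = n then (fps_X ^ (n choose 2) * multisum_coeff t) $ N else 0)" for t
      by (cases t) (auto simp: multisum_term_eq xvar_power_mult_lift_coeffs_nth)
    have "(\<Sum>\<^sub>\<infinity>p\<in>restricted_partitions. xvar ^ length p * qvar ^ sum_list p) $ N $ n =
        (\<Sum>p\<in>?P. (xvar ^ length p * qvar ^ sum_list p) $ N $ n)"
      by (intro infsum_fps_fps_nth finite_partition_support finite_length_sum)
         (auto simp: partition_monomial_nth)
    \<comment> \<open>The two nestings meet here: \<open>$ N $ n\<close> becomes
      \<open>$ n $ N\<close>.\<close>
    also have "\<dots> = list_gf restricted_partitions $ n $ N"
      by (simp add: partition_monomial_nth list_gf_def)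
    also have "\<dots> = (fps_X ^ (n choose 2) * (\<Sum>t\<in>?T. multisum_coeff t)) $ N"
      by (simp add: list_gf_restricted_partitions weighted_series_def)
    also have "\<dots> = (\<Sum>t\<in>?T. (\<lambda>(i, j, k, l). multisum_term i j k l) t $ N $ n)"
      unfolding term_nth by (simp add: sum_distrib_left fps_sum_nth)
    also have "\<dots> = (\<Sum>\<^sub>\<infinity>(i, j, k, l). multisum_term i j k l) $ N $ n"
      by (intro infsum_fps_fps_nth[symmetric] finite_multisum_support T) (auto simp: term_nth)
    finally show "(\<Sum>\<^sub>\<infinity>p\<in>restricted_partitions. xvar ^ length p * qvar ^ sum_list p) $ N $ n =
        (\<Sum>\<^sub>\<infinity>(i, j, k, l). multisum_term i j k l) $ N $ n" .
  qed
qed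

end
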